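(* Let $k,m\ge 1$ be integers. Every stable labeled configuration $\mathcal{C}$ reachable from $\Delta^{k,m}$ is sorted in the following way: on each branch the chips are in increasing order reading from the center outwards. In other words, for all $i\in[k]$ and all $j\in[m-1]$, the chip ending on $v_{i,j}$ has a smaller label than the chip ending on $v_{i,j+1}$.
   Context: Notation: $[n]=\{1,\dots,n\}$. The infinite $k$-star graph $\operatorname{instar}(k)$ is the undirected graph with a center vertex, denoted $v_{i,0}$ for every $i\in[k]$ (all these symbols denote the same vertex), and $k$ branches; branch $i$ is the infinite path $v_{i,0},v_{i,1},v_{i,2},\dots$, with $v_{i,j}$ adjacent to $v_{i,j+1}$ for all $j\ge 0$. So the center has degree $k$ and every other vertex has degree $2$. Labeled chip-firing: there are $N=km$ chips labeled bijectively by $[N]$. A labeled configuration $\mathcal{C}$ assigns to each vertex $v$ the set $\mathcal{C}(v)$ of chips on it. A vertex $v$ is ready to fire if $|\mathcal{C}(v)|\ge\deg(v)$. To fire it, one chooses any $\deg(v)$ of its chips and moves them as follows. When firing the center, if the chosen chips have labels $n_1<\cdots<n_k$, then chip $n_i$ is sent to $v_{i,1}$ for each $i\in[k]$. When firing $v_{i,j}$ with $j\ne 0$, if the two chosen chips have labels $a<b$, then $a$ is sent to $v_{i,j-1}$ and $b$ to $v_{i,j+1}$. Vertices are fired one at a time. A configuration is stable if no vertex is ready to fire, and it is reachable from another configuration if it is obtained by a finite sequence of legal fires. $\Delta^{k,m}$ is the labeled configuration with all $km$ chips on the center. It is known that in every stable configuration reachable from $\Delta^{k,m}$ there is exactly one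 chip on each $v_{i,j}$ with $(i,j)\in[k]\times[m]$ and no chips elsewhere. *)

theory Defs
  imports Main
begin

text \<open>
  Vertices of \<open>instar(k)\<close> are encoded as pairs; all the symbols \<open>v\<^sub>i\<^sub>,\<^sub>0\<close> denote the
  centre, represented by \<open>(0, 0)\<close>. The remaining vertices \<open>v\<^sub>i\<^sub>,\<^sub>j\<close> (\<open>j \<ge> 1\<close>) are the pairs
  \<open>(i, j)\<close> themselves. Branches are numbered \<open>1, \<dots>, k\<close>.
\<close>

type_synonym vertex = "nat \<times> nat"

definition vtx :: "nat \<Rightarrow> nat \<Rightarrow> vertex" where
  "vtx i j = (if j = 0 then (0, 0) else (i, j))"

abbreviation center :: vertex where
  "center \<equiv> (0, 0)"

definition instar_verts :: "nat \<Rightarrow> vertex set" where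
  "instar_verts k = {vtx i j | i j. i \<in> {1..k}}"

definition instar_edges :: "nat \<Rightarrow> vertex set set" where
  "instar_edges k = {{vtx i j, vtx i (j + 1)} | i j. i \<in> {1..k}}"

definition degree :: "nat \<Rightarrow> vertex \<Rightarrow> nat" where
  "degree k u = card {w. {u, w} \<in> instar_edges k}"

type_synonym config = "vertex \<Rightarrow> nat set"

definition ready :: "nat \<Rightarrow> config \<Rightarrow> vertex \<Rightarrow> bool" where
  "ready k C u \<longleftrightarrow> degree k u \<le> card (C u)"

definition stable :: "nat \<Rightarrow> config \<Rightarrow> bool" where
  "stable k C \<longleftrightarrow> (\<forall>u \<in> instar_verts k. \<not> ready k C u)"

text \<open>
  A single legal fire. In the first rule \<open>n 1 < \<dots> < n k\<close> are the chosen chips; values of \<open>n\<close>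
  outside \<open>{1..k}\<close> are irrelevant. In the second rule the three updated vertices are distinct.
\<close>

inductive fire :: "nat \<Rightarrow> config \<Rightarrow> config \<Rightarrow> bool" for k :: nat where
  fire_center:
    "\<lbrakk>ready k C center; strict_mono_on {1..k} n; n ` {1..k} \<subseteq> C center\<rbrakk> \<Longrightarrow>
     fire k C (\<lambda>w. if w = center then C w - n ` {1..k}
                   else C w \<union> {n i | i. i \<in> {1..k} \<and> w = vtx i 1})"
| fire_branch:
    "\<lbrakk>i \<in> {1..k}; j \<noteq> 0; ready k C (vtx i j);
      a \<in> C (vtx i j); b \<in> C (vtx i j); a < b\<rbrakk> \<Longrightarrow>
     fire k C (C(vtx i j := C (vtx i j) - {a, b},
                 vtx i (j - 1) := insert a (C (vtx i (j - 1))),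
                 vtx i (j + 1) := insert b (C (vtx i (j + 1)))))"

definition reachable :: "nat \<Rightarrow> config \<Rightarrow> config \<Rightarrow> bool" where
  "reachable k C C' \<longleftrightarrow> (fire k)\<^sup>*\<^sup>* C C'"

definition initial_config :: "nat \<Rightarrow> nat \<Rightarrow> config" where
  "initial_config k m = (\<lambda>w. if w = center then {1..k * m} else {})"

lemma degree_center: "degree k center = k"
proof -
  have "{w. {center, w} \<in> instar_edges k} = (\<lambda>i. (i, 1)) ` {1..k}"
    by (auto simp: instar_edges_def vtx_def doubleton_eq_iff split: if_splits)
  then show ?thesis
    by (simp add: degree_def card_image inj_on_def)
qed

lemma degree_branch:
  assumes "i \<in> {1..k}" "j \<noteq> 0"
  shows "degree k (vtx i j) = 2"
proof -
  have "w = vtx i (j - 1) \<or> w = vtx i (j + 1)" if "{vtx i j, w} \<in> instar_edges k" for w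
    using that assms
    by (auto simp: instar_edges_def vtx_def doubleton_eq_iff split: if_splits)
  moreover have "{vtx i j, vtx i (j + 1)} \<in> instar_edges k"
    using assms unfolding instar_edges_def by blast
  moreover have "{vtx i j, vtx i (j - 1)} \<in> instar_edges k"
  proof -
    have "{vtx i j, vtx i (j - 1)} = {vtx i (j - 1), vtx i (j - 1 + 1)}"
      using assms by (simp add: insert_commute)
    then show ?thesis using assms unfolding instar_edges_def by blast
  qed
  ultimately have "{w. {vtx i j, w} \<in> instar_edges k} = {vtx i (j - 1), vtx i (j + 1)}"
    by blast
  moreover have "vtx i (j - 1) \<noteq> vtx i (j + 1)"
    using assms by (auto simp: vtx_def)
  ultimately show ?thesis by (simp add: degree_def)
qed

end

theory Submission
  imports Defs
begin

text \<open>
  Look at a stabilising run from its end, and let \<open>F(j, t)\<close> be the \<open>t\<close>-th last fire of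
  \<open>v\<^sub>i\<^sub>,\<^sub>j\<close> on a fixed branch \<open>i\<close>. The order of these fires turns out to be rigid in the triangle
  \<open>j + t \<le> m\<close>, and there the labels are sorted as by a comparator network.

  The number of fires of each vertex is determined: \<open>v\<^sub>i\<^sub>,\<^sub>j\<close> fires \<open>0 + 1 + \<dots> + (m - j)\<close> times
  (\<open>fired_total\<close>). The least action principle gives the upper bound; stability makes the
  deficit convex along each branch, which forces it to vanish. In particular the final numbers of
  chips are known, so the number of chips on a vertex at any time can be expressed by the numbers
  \<open>x\<^sub>j\<close> of fires that are still to come: it is \<open>1 + 2 x\<^sub>j - x\<^sub>j\<^sub>-\<^sub>1 - x\<^sub>j\<^sub>+\<^sub>1\<close> for \<open>1 \<le> j \<le> m\<close>, and \<open>k x\<^sub>0\<close>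
  minus the sum of the \<open>x\<^sub>1\<close> over all branches at the centre.

  That these numbers are nonnegative implies (\<open>last_fires_interleave\<close>) that exactly \<open>t\<close> fires of
  \<open>v\<^sub>i\<^sub>,\<^sub>j\<^sub>-\<^sub>1\<close> (if \<open>j > 0\<close>) and \<open>t - 1\<close> fires of \<open>v\<^sub>i\<^sub>,\<^sub>j\<^sub>+\<^sub>1\<close> come after \<open>F(j, t)\<close>, and hence that
  \<open>F(j, t)\<close> leaves its vertex empty. Let \<open>b(j, t)\<close> be the chip that \<open>F(j, t)\<close> sends to \<open>v\<^sub>i\<^sub>,\<^sub>j\<^sub>+\<^sub>1\<close> and, for \<open>j > 0\<close>, let
  \<open>a(j, t) < b(j, t)\<close> be the one that it sends to \<open>v\<^sub>i\<^sub>,\<^sub>j\<^sub>-\<^sub>1\<close>. When \<open>j > 0\<close> and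
  \<open>j + t < m\<close>, the vertex was empty after \<open>F(j, t + 1)\<close>, and between the two fires it received exactly
  \<open>b(j - 1, t + 1)\<close> and \<open>a(j + 1, t)\<close>; therefore
  \<open>{a(j, t), b(j, t)} = {b(j - 1, t + 1), a(j + 1, t)}\<close>.

  From this \<open>b(j - 1, t) < b(j, t)\<close> follows by induction on \<open>j\<close>
  (\<open>outward_chips_increase\<close>): \<open>b(j - 1, t)\<close> is either \<open>a(j, t)\<close>, which is below \<open>b(j, t)\<close>, or
  \<open>b(j - 2, t + 1) < b(j - 1, t + 1) \<le> b(j, t)\<close>. The base case \<open>j = 1\<close>,
  where \<open>b(0, t)\<close> comes from the centre, is a count (\<open>center_outward_chip_less\<close>). Since \<open>b(j - 1, 1)\<close> is the chip that ends on \<open>v\<^sub>i\<^sub>,\<^sub>j\<close>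
  (\<open>final_chip\<close>), the case \<open>t = 1\<close> is the theorem.
\<close>

section \<open>A single fire\<close>

text \<open>
  The relation \<open>fire\<close> with the fired vertex and the moved chips made explicit: \<open>hi i\<close> is the chip
  that moves outwards on branch \<open>i\<close>, and \<open>lo\<close> is the chip that moves inwards. With \<open>hi\<close> indexed by
  branches, the centre and the other vertices of branch \<open>i\<close> are alike in that they send \<open>hi i\<close> to
  the next vertex.
\<close>

inductive labeled_fire ::
  "nat \<Rightarrow> vertex \<Rightarrow> nat \<Rightarrow> (nat \<Rightarrow> nat) \<Rightarrow> config \<Rightarrow> config \<Rightarrow> bool" for k :: nat where
  at_center:
    "\<lbrakk>strict_mono_on {1..k} hi; hi ` {1..k} \<subseteq> C center\<rbrakk> \<Longrightarrow>
     labeled_fire k center lo hi C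
       (\<lambda>w. if w = center then C w - hi ` {1..k}
            else C w \<union> {hi i | i. i \<in> {1..k} \<and> w = vtx i 1})"
| at_branch:
    "\<lbrakk>i \<in> {1..k}; j \<noteq> 0; lo \<in> C (vtx i j); hi i \<in> C (vtx i j); lo < hi i\<rbrakk> \<Longrightarrow>
     labeled_fire k (vtx i j) lo hi C
       (C(vtx i j := C (vtx i j) - {lo, hi i},
          vtx i (j - 1) := insert lo (C (vtx i (j - 1))),
          vtx i (j + 1) := insert (hi i) (C (vtx i (j + 1)))))"

lemma fire_imp_labeled_fire:
  assumes "fire k C C'"
  shows "\<exists>v lo hi. labeled_fire k v lo hi C C'"
  using assms
proof cases
  case (fire_center n)
  then show ?thesis using at_center by blast
next
  case (fire_branch i j a b)
  have "labeled_fire k (vtx i j) a (\<lambda>_. b) C C'"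
    unfolding fire_branch(1) by (rule at_branch) (use fire_branch in auto)
  then show ?thesis by blast
qed

lemma vtx_0 [simp]: "vtx i 0 = center"
  by (simp add: vtx_def)

lemma vtx_eq_iff: "vtx i j = vtx i' j' \<longleftrightarrow> j = j' \<and> (j = 0 \<or> i = i')"
  by (auto simp: vtx_def)

lemma center_eq_vtx_iff: "center = vtx i j \<longleftrightarrow> j = 0" "vtx i j = center \<longleftrightarrow> j = 0"
  by (auto simp: vtx_def)

lemmas vtx_iffs = vtx_eq_iff center_eq_vtx_iff

lemma labeled_fire_branch_update:
  assumes "labeled_fire k v lo hi C C'" "i \<in> {1..k}" "j \<ge> 1"
  shows "C' (vtx i j) =
    (C (vtx i j) - (if v = vtx i j then {lo, hi i} else {}))
      \<union> (if v = vtx i (j - 1) then {hi i} else {})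
      \<union> (if v = vtx i (j + 1) then {lo} else {})"
  using assms
proof cases
  case at_center
  then show ?thesis using assms(2,3) by (auto simp: vtx_iffs)
next
  case (at_branch i' j')
  then show ?thesis using assms(2,3) by (auto simp: vtx_iffs)
qed

lemma labeled_fire_center_update:
  assumes "labeled_fire k v lo hi C C'"
  shows "C' center =
    (C center - (if v = center then hi ` {1..k} else {}))
      \<union> (if \<exists>i\<in>{1..k}. v = vtx i 1 then {lo} else {})"
  using assms
proof cases
  case at_center
  then show ?thesis by (auto simp: vtx_iffs)
next
  case (at_branch i' j')
  then show ?thesis by (auto simp: vtx_iffs)
qed

lemma labeled_fire_at_center:
  assumes "labeled_fire k center lo hi C C'"
  shows "strict_mono_on {1..k} hi" "hi ` {1..k} \<subseteq> C center"
proof -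
  have "strict_mono_on {1..k} hi \<and> hi ` {1..k} \<subseteq> C center"
    using assms by cases (simp_all add: center_eq_vtx_iff)
  then show "strict_mono_on {1..k} hi" "hi ` {1..k} \<subseteq> C center" by blast+
qed

lemma labeled_fire_at_branch:
  assumes "labeled_fire k (vtx i j) lo hi C C'" "j \<ge> 1"
  shows "lo < hi i" "lo \<in> C (vtx i j)" "hi i \<in> C (vtx i j)"
proof -
  have "lo < hi i \<and> lo \<in> C (vtx i j) \<and> hi i \<in> C (vtx i j)"
    using assms by cases (auto simp: vtx_iffs)
  then show "lo < hi i" "lo \<in> C (vtx i j)" "hi i \<in> C (vtx i j)" by blast+
qed

text \<open>
  Cardinalities of the contents count chips only as long as no chip lies on two vertices: otherwise
  a chip could arrive where it already is.
\<close>

definition separated :: "config \<Rightarrow> bool" where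
  "separated C \<longleftrightarrow> (\<forall>v. finite (C v)) \<and> (\<forall>c v w. c \<in> C v \<longrightarrow> c \<in> C w \<longrightarrow> v = w)"

lemma separated_finite: "separated C \<Longrightarrow> finite (C v)"
  unfolding separated_def by blast

lemma separated_unique: "separated C \<Longrightarrow> c \<in> C v \<Longrightarrow> c \<in> C w \<Longrightarrow> v = w"
  unfolding separated_def by blast

lemma separated_labeled_fire:
  assumes "labeled_fire k v lo hi C C'" "separated C"
  shows "separated C'"
  using assms(1)
proof cases
  case at_center
  note uniq = separated_unique[OF assms(2)]
  have inj: "inj_on hi {1..k}"
    using at_center(3) by (rule strict_mono_on_imp_inj_on)
  have "finite {hi i |i. i \<in> {1..k} \<and> w = vtx i 1}" for w
    by (rule finite_subset[of _ "hi ` {1..k}"]) auto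
  then have "finite (C' w)" for w
    using separated_finite[OF assms(2)] at_center(2) by simp
  moreover have "x = y" if "c \<in> C' x" "c \<in> C' y" for c x y
  proof -
    have moved: "(c \<in> C w \<and> (w = center \<longrightarrow> c \<notin> hi ` {1..k})) \<or> (\<exists>i\<in>{1..k}. c = hi i \<and> w = vtx i 1)"
      if "c \<in> C' w" for w
      using that unfolding at_center(2) by (auto split: if_splits)
    have clash: False if "c \<in> C w" "w = center \<longrightarrow> c \<notin> hi ` {1..k}" "i \<in> {1..k}" "c = hi i" for w i
      using that uniq[of c w center] at_center(4) by blast
    from moved[OF that(1)] moved[OF that(2)] show ?thesis
      using uniq clash inj_onD[OF inj] by metis
  qed
  ultimately show ?thesis unfolding separated_def by blast
next
  case (at_branch i j)
  note uniq = separated_unique[OF assms(2)]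
  have "finite (C' w)" for w
    using separated_finite[OF assms(2)] at_branch(2) by simp
  moreover have "x = y" if "c \<in> C' x" "c \<in> C' y" for c x y
  proof -
    have moved: "(c = lo \<and> w = vtx i (j - 1)) \<or> (c = hi i \<and> w = vtx i (j + 1))
        \<or> (c \<in> C w \<and> (c \<in> {lo, hi i} \<longrightarrow> w \<noteq> vtx i j))" if "c \<in> C' w" for w
      using that at_branch(4) unfolding at_branch(2) by (auto simp: fun_upd_def vtx_eq_iff split: if_splits)
    have clash: False if "c \<in> C w" "c \<in> {lo, hi i}" "w \<noteq> vtx i j" for w
      using that uniq[of c w "vtx i j"] at_branch(5,6) by blast
    from moved[OF that(1)] moved[OF that(2)] show ?thesis
      using uniq clash at_branch(7) by (metis insertCI less_irrefl)
  qed
  ultimately show ?thesis unfolding separated_def by blast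
qed

lemma card_labeled_fire_branch:
  assumes fire: "labeled_fire k v lo hi C C'" and sep: "separated C"
    and ij: "i \<in> {1..k}" "j \<ge> 1"
  shows "int (card (C' (vtx i j))) =
    int (card (C (vtx i j))) - 2 * of_bool (v = vtx i j)
      + of_bool (v = vtx i (j - 1)) + of_bool (v = vtx i (j + 1))"
proof -
  note fin = separated_finite[OF sep] and uniq = separated_unique[OF sep]
  consider "v = vtx i j" | "v = vtx i (j - 1)" | "v = vtx i (j + 1)"
    | "v \<noteq> vtx i j" "v \<noteq> vtx i (j - 1)" "v \<noteq> vtx i (j + 1)" by blast
  then show ?thesis
  proof cases
    case 1
    note f = labeled_fire_at_branch[OF fire[unfolded 1] ij(2)]
    have "card {lo, hi i} \<le> card (C (vtx i j))" using f fin by (intro card_mono) auto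
    moreover have "card (C (vtx i j) - {lo, hi i}) = card (C (vtx i j)) - card {lo, hi i}"
      using f by (intro card_Diff_subset) auto
    moreover have "card {lo, hi i} = 2" using f by simp
    ultimately show ?thesis
      using labeled_fire_branch_update[OF fire ij] 1 ij by (simp add: vtx_iffs)
  next
    case 2
    have "hi i \<in> C v"
    proof (cases "j = 1")
      case True
      then show ?thesis using 2 labeled_fire_at_center(2)[of k lo hi C C'] fire ij by auto
    next
      case False
      then show ?thesis using 2 labeled_fire_at_branch(3)[of k i "j - 1" lo hi C C'] fire ij by auto
    qed
    then have "hi i \<notin> C (vtx i j)" using uniq[of "hi i" v "vtx i j"] 2 ij by (auto simp: vtx_iffs)
    moreover have "j - 1 \<noteq> j" "j - 1 \<noteq> j + 1" using ij(2) by auto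
    ultimately show ?thesis
      using labeled_fire_branch_update[OF fire ij] 2 fin by (simp add: vtx_iffs)
  next
    case 3
    have "lo \<in> C v" using labeled_fire_at_branch(2)[of k i "j + 1" lo hi C C'] fire 3 by auto
    then have "lo \<notin> C (vtx i j)" using uniq[of lo v "vtx i j"] 3 by (auto simp: vtx_iffs)
    then show ?thesis
      using labeled_fire_branch_update[OF fire ij] 3 ij fin by (simp add: vtx_iffs)
  next
    case 4
    then show ?thesis using labeled_fire_branch_update[OF fire ij] by simp
  qed
qed

lemma card_labeled_fire_center:
  assumes fire: "labeled_fire k v lo hi C C'" and sep: "separated C"
  shows "int (card (C' center)) =
    int (card (C center)) - int k * of_bool (v = center) + (\<Sum>i\<in>{1..k}. of_bool (v = vtx i 1))"
proof -
  note fin = separated_finite[OF sep] and uniq = separated_unique[OF sep]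
  consider "v = center" | i where "i \<in> {1..k}" "v = vtx i 1"
    | "v \<noteq> center" "\<forall>i\<in>{1..k}. v \<noteq> vtx i 1" by blast
  then show ?thesis
  proof cases
    case 1
    note f = labeled_fire_at_center[OF fire[unfolded 1]]
    have "card (hi ` {1..k}) = k"
      using strict_mono_on_imp_inj_on[OF f(1)] by (simp add: card_image)
    moreover have "card (hi ` {1..k}) \<le> card (C center)" using f fin by (intro card_mono) auto
    moreover have "card (C center - hi ` {1..k}) = card (C center) - card (hi ` {1..k})"
      using f by (intro card_Diff_subset) auto
    ultimately show ?thesis
      using labeled_fire_center_update[OF fire] 1 by (simp add: vtx_iffs)
  next
    case 2
    have "lo \<in> C v" using labeled_fire_at_branch(2)[of k i 1 lo hi C C'] fire 2 by auto
    then have "lo \<notin> C center" using uniq[of lo v center] 2 by (auto simp: vtx_iffs)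
    moreover have "(\<Sum>i'\<in>{1..k}. of_bool (v = vtx i' 1)) = (\<Sum>i'\<in>{1..k}. if i = i' then 1 else 0 :: int)"
      using 2 by (intro sum.cong) (auto simp: vtx_iffs)
    moreover have "\<dots> = 1" using 2(1) by (subst sum.delta') auto
    moreover have "\<exists>i\<in>{1..k}. v = vtx i 1" using 2 by blast
    ultimately show ?thesis
      using labeled_fire_center_update[OF fire] 2 fin by (simp add: vtx_iffs)
  next
    case 3
    then have "(\<Sum>i\<in>{1..k}. of_bool (v = vtx i 1)) = (0::int)" by (intro sum.neutral) auto
    then show ?thesis using labeled_fire_center_update[OF fire] 3 by auto
  qed
qed

section \<open>Stabilising runs\<close>

lemma reachable_imp_run:
  assumes "reachable k C D"
  shows "\<exists>T Cs site lo hi. Cs 0 = C \<and> Cs T = D \<and>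
    (\<forall>s<T. labeled_fire k (site s) (lo s) (hi s) (Cs s) (Cs (Suc s)))"
proof -
  from assms obtain T where "(fire k ^^ T) C D"
    by (auto simp: reachable_def rtranclp_power)
  then obtain Cs where Cs: "Cs 0 = C" "Cs T = D" "\<forall>s<T. fire k (Cs s) (Cs (Suc s))"
    by (auto simp: relpowp_fun_conv)
  then have "\<forall>s. \<exists>v lo hi. s < T \<longrightarrow> labeled_fire k v lo hi (Cs s) (Cs (Suc s))"
    using fire_imp_labeled_fire by blast
  then obtain site lo hi where
    "\<forall>s. s < T \<longrightarrow> labeled_fire k (site s) (lo s) (hi s) (Cs s) (Cs (Suc s))"
    by metis
  with Cs show ?thesis by blast
qed

text \<open>
  Convexity propagates the initial ascent \<open>w 0 \<le> w 1\<close> along the whole segment, so the end value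
  \<open>w n = 0\<close> is the maximum.
\<close>

lemma convex_nonpos:
  fixes w :: "nat \<Rightarrow> int"
  assumes convex: "\<And>j. 1 \<le> j \<Longrightarrow> j < n \<Longrightarrow> 2 * w j \<le> w (j - 1) + w (j + 1)"
    and "w 0 \<le> w 1" "w n = 0" "j \<le> n"
  shows "w j \<le> 0"
proof -
  have mono: "w l \<le> w (Suc l)" if "l < n" for l
    using that
  proof (induction l)
    case 0
    then show ?case using assms by simp
  next
    case (Suc l)
    then show ?case using convex[of "Suc l"] by simp
  qed
  have "w (n - d) \<le> 0" if "d \<le> n" for d
    using that
  proof (induction d)
    case 0
    then show ?case using assms by simp
  next
    case (Suc d)
    then show ?case using mono[of "n - Suc d"] by (simp add: Suc_diff_Suc)
  qed
  from this[of "n - j"] show ?thesis using assms by simp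
qed

locale stabilizing_run =
  fixes k m T :: nat and C :: "nat \<Rightarrow> config"
    and site :: "nat \<Rightarrow> vertex" and lo :: "nat \<Rightarrow> nat" and hi :: "nat \<Rightarrow> nat \<Rightarrow> nat"
  assumes k_pos: "k \<ge> 1"
    and start: "C 0 = initial_config k m"
    and step: "s < T \<Longrightarrow> labeled_fire k (site s) (lo s) (hi s) (C s) (C (Suc s))"
    and stop: "stable k (C T)"
begin

definition fired :: "nat \<Rightarrow> vertex \<Rightarrow> nat" where
  "fired s v = (\<Sum>q<s. of_bool (site q = v))"

lemma fired_0 [simp]: "fired 0 v = 0"
  by (simp add: fired_def)

lemma fired_Suc: "fired (Suc s) v = fired s v + of_bool (site s = v)"
  by (simp add: fired_def)

lemma fired_mono: "s \<le> s' \<Longrightarrow> fired s v \<le> fired s' v"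
  by (rule lift_Suc_mono_le[of "\<lambda>s. fired s v"]) (auto simp: fired_Suc)

lemma separated_run: "s \<le> T \<Longrightarrow> separated (C s)"
proof (induction s)
  case 0
  show ?case by (auto simp: start initial_config_def separated_def)
next
  case (Suc s)
  then show ?case using separated_labeled_fire[OF step] by simp
qed

lemma finite_run: "s \<le> T \<Longrightarrow> finite (C s v)"
  by (rule separated_finite[OF separated_run])

lemma card_branch:
  assumes "s \<le> T" "i \<in> {1..k}" "j \<ge> 1"
  shows "int (card (C s (vtx i j))) =
    int (fired s (vtx i (j - 1))) + int (fired s (vtx i (j + 1))) - 2 * int (fired s (vtx i j))"
  using assms(1)
proof (induction s)
  case 0
  then show ?case using assms by (simp add: start initial_config_def vtx_iffs)
next
  case (Suc s)
  then show ?case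
    using card_labeled_fire_branch[OF step separated_run assms(2,3), of s] by (simp add: fired_Suc)
qed

lemma card_center:
  assumes "s \<le> T"
  shows "int (card (C s center)) =
    int k * int m + (\<Sum>i\<in>{1..k}. int (fired s (vtx i 1))) - int k * int (fired s center)"
  using assms
proof (induction s)
  case 0
  then show ?case by (simp add: start initial_config_def)
next
  case (Suc s)
  then show ?case
    using card_labeled_fire_center[OF step separated_run, of s]
    by (simp add: fired_Suc sum.distrib algebra_simps)
qed

section \<open>The number of times each vertex fires\<close>

text \<open>
  The values that the firing numbers have to take, in closed form \<open>(m - j) (m - j + 1) / 2\<close> for
  \<open>j \<le> m\<close>.
\<close>

definition odometer :: "nat \<Rightarrow> nat" where
  "odometer j = \<Sum>{..m - j}"

lemma odometer_Suc: "odometer j = odometer (Suc j) + (m - j)"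
proof (cases "j < m")
  case True
  then have "m - j = Suc (m - Suc j)" by simp
  then show ?thesis by (simp add: odometer_def)
qed (simp add: odometer_def)

lemma odometer_ge: "m - j \<le> odometer j"
  using odometer_Suc[of j] by simp

lemma odometer_beyond: "m \<le> j \<Longrightarrow> odometer j = 0"
  by (simp add: odometer_def)

text \<open>
  The discrete Laplacian of the odometer gives the final numbers of chips, by \<open>card_branch\<close>.
\<close>

lemma odometer_curvature:
  assumes "j \<ge> 1"
  shows "int (odometer (j - 1)) + int (odometer (j + 1)) - 2 * int (odometer j) = of_bool (j \<le> m)"
  using odometer_Suc[of "j - 1"] odometer_Suc[of j] assms by (auto simp: of_nat_diff)

text \<open>
  Least action principle. At the first violation the firing vertex \<open>v\<close> has already fired
  as often as the odometer says while its neighbours have fired at most that often. So \<open>v\<close> holds no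
  more chips than in the final configuration of the odometer, too few to fire.
\<close>

lemma fired_le_odometer:
  assumes "s \<le> T" "i \<in> {1..k}"
  shows "fired s (vtx i j) \<le> odometer j"
  using assms
proof (induction s arbitrary: i j)
  case 0
  show ?case by simp
next
  case (Suc s)
  then have s: "s < T" "s \<le> T" by auto
  note IH = Suc.IH[OF s(2)]
  note fire = step[OF s(1)]
  have "fired s (vtx i j) < odometer j" if site: "site s = vtx i j"
  proof (rule ccontr)
    assume "\<not> ?thesis"
    then have eq: "fired s (vtx i j) = odometer j" using IH[OF Suc.prems(2), of j] by simp
    show False
    proof (cases "j = 0")
      case True
      have f: "strict_mono_on {1..k} (hi s)" "hi s ` {1..k} \<subseteq> C s center"
        using labeled_fire_at_center[of k "lo s" "hi s"] fire site True by auto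
      have "k = card (hi s ` {1..k})"
        using strict_mono_on_imp_inj_on[OF f(1)] by (simp add: card_image)
      also have "\<dots> \<le> card (C s center)"
        using f(2) finite_run[OF s(2)] by (intro card_mono)
      finally have ge: "k \<le> card (C s center)" .
      have "(\<Sum>i\<in>{1..k}. int (fired s (vtx i 1))) \<le> (\<Sum>i\<in>{1..k}. int (odometer 1))"
        using IH[of _ 1] by (intro sum_mono) simp
      then have "int (card (C s center)) \<le> int k * (int m + int (odometer 1) - int (odometer 0))"
        using card_center[OF s(2)] eq True by (simp add: algebra_simps)
      then show False using ge k_pos odometer_Suc[of 0] by simp
    next
      case False
      then have j: "j \<ge> 1" by simp
      have f: "lo s < hi s i" "lo s \<in> C s (vtx i j)" "hi s i \<in> C s (vtx i j)"
        using labeled_fire_at_branch[of k i j] fire site j by auto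
      have "card {lo s, hi s i} \<le> card (C s (vtx i j))"
        using f finite_run[OF s(2)] by (intro card_mono) auto
      then have "2 \<le> card (C s (vtx i j))" using f by simp
      moreover have "int (card (C s (vtx i j))) \<le> 1"
        using card_branch[OF s(2) Suc.prems(2) j] odometer_curvature[OF j] eq
          IH[OF Suc.prems(2), of "j - 1"] IH[OF Suc.prems(2), of "j + 1"]
        by (auto simp: of_bool_def split: if_splits)
      ultimately show False by simp
    qed
  qed
  then show ?case using IH[OF Suc.prems(2), of j] by (auto simp: fired_Suc)
qed

lemma stable_branch: "i \<in> {1..k} \<Longrightarrow> j \<ge> 1 \<Longrightarrow> card (C T (vtx i j)) < 2"
proof -
  assume ij: "i \<in> {1..k}" "j \<ge> 1"
  then have "vtx i j \<in> instar_verts k" unfolding instar_verts_def by blast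
  then have "\<not> degree k (vtx i j) \<le> card (C T (vtx i j))"
    using stop unfolding stable_def ready_def by blast
  then show ?thesis using degree_branch[of i k j] ij by simp
qed

lemma stable_center: "card (C T center) < k"
proof -
  have "center \<in> instar_verts k"
    unfolding instar_verts_def using k_pos by (auto simp: center_eq_vtx_iff intro!: exI[of _ 1])
  then have "\<not> degree k center \<le> card (C T center)"
    using stop unfolding stable_def ready_def by blast
  then show ?thesis by (simp add: degree_center)
qed

text \<open>
  Let \<open>w\<close> be the odometer minus the actual firing numbers. Since the final configuration has at
  most one chip on each branch vertex, \<open>w\<close> is convex on every branch up to \<open>m\<close>, where it vanishes.
  Since the centre ends with fewer than \<open>k\<close> chips, \<open>w\<close> does not decrease along the first edge of
  some branch; by convexity \<open>w \<le> 0\<close> on that branch, hence at the centre. But \<open>w \<ge> 0\<close> everywhere,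
  so now \<open>w\<close> does not decrease along the first edge of any branch.
\<close>

lemma fired_total:
  assumes "i \<in> {1..k}"
  shows "fired T (vtx i j) = odometer j"
proof -
  define w where "w i j = int (odometer j) - int (fired T (vtx i j))" for i j
  have w_nonneg: "w i j \<ge> 0" if "i \<in> {1..k}" for i j
    using fired_le_odometer[of T i j] that by (simp add: w_def)
  have w_beyond: "w i j = 0" if "i \<in> {1..k}" "j \<ge> m" for i j
    using fired_le_odometer[of T i j] that odometer_beyond[of j] by (simp add: w_def)
  have vanish: "w i j \<le> 0" if i: "i \<in> {1..k}" and "w i 0 \<le> w i 1" for i j
  proof (cases "j \<le> m")
    case True
    show ?thesis
    proof (rule convex_nonpos[of m "w i"])
      fix l assume l: "1 \<le> l" "l < m"
      show "2 * w i l \<le> w i (l - 1) + w i (l + 1)"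
        using card_branch[OF order_refl i l(1)] stable_branch[OF i l(1)] odometer_curvature[OF l(1)] l
        by (simp add: w_def)
    qed (use that True w_beyond in auto)
  next
    case False
    then show ?thesis using w_beyond i by simp
  qed
  have w0: "w i 0 = w 1 0" for i by (simp add: w_def)
  have "\<exists>i\<in>{1..k}. w 1 0 \<le> w i 1"
  proof (rule ccontr)
    assume "\<not> ?thesis"
    then have "(\<Sum>i\<in>{1..k}. w i 1) \<le> (\<Sum>i\<in>{1..k}. w 1 0 - 1)" by (intro sum_mono) force
    then have "(\<Sum>i\<in>{1..k}. w i 1) \<le> int k * (w 1 0 - 1)" by simp
    moreover have "(\<Sum>i\<in>{1..k}. w i 1) = int k * int (odometer 1) - (\<Sum>i\<in>{1..k}. int (fired T (vtx i 1)))"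
      by (simp add: w_def sum_subtractf)
    moreover have "int k * w 1 0 = int k * int (odometer 1) + int k * int m - int k * int (fired T center)"
      using odometer_Suc[of 0] by (simp add: w_def algebra_simps)
    ultimately have "int k \<le> int (card (C T center))"
      using card_center[OF order_refl] by (simp add: algebra_simps)
    then show False using stable_center by simp
  qed
  then obtain i0 where "i0 \<in> {1..k}" "w 1 0 \<le> w i0 1" by blast
  then have "w i 0 \<le> 0" using vanish[of i0 0] w0 by metis
  then have "w i 0 \<le> w i 1" using w_nonneg[OF assms, of 1] by simp
  then have "w i j = 0" using vanish[OF assms, of j] w_nonneg[OF assms, of j] by simp
  then show ?thesis by (simp add: w_def)
qed

lemma card_final:
  assumes "i \<in> {1..k}" "1 \<le> j" "j \<le> m"
  shows "card (C T (vtx i j)) = 1"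
  using card_branch[OF order_refl assms(1,2)] odometer_curvature[OF assms(2)] assms(3)
  by (simp add: fired_total[OF assms(1)])

section \<open>The order of the last fires\<close>

text \<open>
  The number of fires of a vertex from step \<open>s\<close> on, the fire at step \<open>s\<close> itself included.
\<close>

definition remaining :: "nat \<Rightarrow> nat \<Rightarrow> nat \<Rightarrow> nat" where
  "remaining s i j = fired T (vtx i j) - fired s (vtx i j)"

lemma remaining_antimono: "s \<le> s' \<Longrightarrow> remaining s' i j \<le> remaining s i j"
  using fired_mono[of s s' "vtx i j"] by (simp add: remaining_def)

lemma remaining_Suc:
  assumes "s < T"
  shows "remaining s i j = remaining (Suc s) i j + of_bool (site s = vtx i j)"
  using fired_mono[of "Suc s" T "vtx i j"] assms by (simp add: remaining_def fired_Suc)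

lemma remaining_T [simp]: "remaining T i j = 0"
  by (simp add: remaining_def)

lemma remaining_0: "i \<in> {1..k} \<Longrightarrow> remaining 0 i j = odometer j"
  by (simp add: remaining_def fired_total)

lemma remaining_center: "remaining s i 0 = remaining s i' 0"
  by (simp add: remaining_def)

lemma int_remaining:
  assumes "s \<le> T" "i \<in> {1..k}"
  shows "int (remaining s i j) = int (odometer j) - int (fired s (vtx i j))"
  using fired_mono[OF assms(1), of "vtx i j"] fired_total[OF assms(2), of j]
  by (simp add: remaining_def)

lemma card_branch_remaining:
  assumes "s \<le> T" "i \<in> {1..k}" "1 \<le> j" "j \<le> m"
  shows "int (card (C s (vtx i j))) =
    1 + 2 * int (remaining s i j) - int (remaining s i (j - 1)) - int (remaining s i (j + 1))"
  using card_branch[OF assms(1-3)] odometer_curvature[OF assms(3)] assms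
  by (simp add: int_remaining)

lemma card_center_remaining:
  assumes "s \<le> T" "i \<in> {1..k}"
  shows "int (card (C s center)) =
    int k * int (remaining s i 0) - (\<Sum>i'\<in>{1..k}. int (remaining s i' 1))"
proof -
  have "(\<Sum>i'\<in>{1..k}. int (remaining s i' 1)) =
      int k * int (odometer 1) - (\<Sum>i\<in>{1..k}. int (fired s (vtx i 1)))"
    using assms by (simp add: int_remaining sum_subtractf)
  then show ?thesis using card_center[OF assms(1)] odometer_Suc[of 0] assms
    by (simp add: int_remaining algebra_simps)
qed

text \<open>
  Step \<open>s\<close> is the \<open>t\<close>-th last fire of \<open>v\<^sub>i\<^sub>,\<^sub>j\<close>. For \<open>j = 0\<close> it is a fire of the centre,
  the same one for every \<open>i\<close>.
\<close>

definition is_nth_last :: "nat \<Rightarrow> nat \<Rightarrow> nat \<Rightarrow> nat \<Rightarrow> bool" where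
  "is_nth_last i j t s \<longleftrightarrow> s < T \<and> site s = vtx i j \<and> remaining s i j = t"

lemma is_nth_lastD:
  assumes "is_nth_last i j t s"
  shows "s < T" "site s = vtx i j" "remaining s i j = t" "remaining (Suc s) i j = t - 1" "t \<ge> 1"
  using assms remaining_Suc[of s i j] by (auto simp: is_nth_last_def)

lemma remaining_neighbor:
  assumes "is_nth_last i j t s" "j' \<noteq> j"
  shows "remaining (Suc s) i' j' = remaining s i' j'"
  using is_nth_lastD[OF assms(1)] assms(2) remaining_Suc[of s i' j'] by (simp add: vtx_iffs)

text \<open>
  In the triangle \<open>j + t \<le> m\<close> the fire exists because the odometer at \<open>j\<close> is at least \<open>m - j\<close>.
\<close>

lemma is_nth_last_exists:
  assumes "i \<in> {1..k}" "1 \<le> t" "j + t \<le> m"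
  shows "\<exists>s. is_nth_last i j t s"
proof -
  let ?P = "\<lambda>s. remaining s i j < t"
  have P: "?P T" "\<not> ?P 0"
    using assms odometer_ge[of j] by (auto simp: remaining_0)
  define s where "s = (LEAST s. ?P s)"
  have s: "?P s" "\<And>q. q < s \<Longrightarrow> \<not> ?P q" "s \<le> T"
    unfolding s_def using LeastI[of ?P T] Least_le[of ?P T] not_less_Least[of _ ?P] P(1) by blast+
  then obtain q where q: "s = Suc q" using P(2) by (cases s) auto
  then have "\<not> ?P q" "q < T" using s by auto
  then have "is_nth_last i j t q"
    using s(1) q remaining_Suc[of q i j] by (cases "site q = vtx i j") (auto simp: is_nth_last_def)
  then show ?thesis by blast
qed

lemma is_nth_last_unique:
  assumes "is_nth_last i j t s" "is_nth_last i j t s'"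
  shows "s = s'"
proof (rule ccontr)
  assume "s \<noteq> s'"
  then consider "Suc s \<le> s'" | "Suc s' \<le> s" by linarith
  then show False
    using is_nth_lastD[OF assms(1)] is_nth_lastD[OF assms(2)]
      remaining_antimono[of "Suc s" s' i j] remaining_antimono[of "Suc s'" s i j]
    by cases auto
qed

lemma after_nth_last:
  assumes "is_nth_last i j t s" "remaining q i j < t"
  shows "Suc s \<le> q"
proof (rule ccontr)
  assume "\<not> Suc s \<le> q"
  then show False
    using is_nth_lastD[OF assms(1)] assms(2) remaining_antimono[of q s i j] by simp
qed

text \<open>
  The position of the \<open>t\<close>-th last fires at distance \<open>j\<close> among the fires of the neighbouring vertices.
  The disjunction \<open>j = 0 \<or> i' = i\<close> makes the outward neighbours range over all branches at the
  centre and over the own branch elsewhere. The lemmas \<open>interleaves_inward\<close> and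
  \<open>interleaves_outward\<close> carry these values, as bounds, from the moment after the fire to all later
  moments.
\<close>

definition interleaves :: "nat \<Rightarrow> nat \<Rightarrow> bool" where
  "interleaves j t \<longleftrightarrow> (\<forall>i\<in>{1..k}. \<forall>s. is_nth_last i j t s \<longrightarrow>
     (j \<ge> 1 \<longrightarrow> remaining (Suc s) i (j - 1) = t) \<and>
     (\<forall>i'\<in>{1..k}. (j = 0 \<or> i' = i) \<longrightarrow> remaining (Suc s) i' (j + 1) = t - 1))"

lemma interleaves_inward:
  assumes "interleaves j t" "i \<in> {1..k}" "1 \<le> t" "1 \<le> j" "j + t \<le> m" "remaining s i j < t"
  shows "remaining s i (j - 1) \<le> t"
proof -
  obtain q where q: "is_nth_last i j t q" using is_nth_last_exists[OF assms(2,3,5)] by blast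
  show ?thesis
    using after_nth_last[OF q assms(6)] remaining_antimono[of "Suc q" s i "j - 1"]
      assms(1,2,4) q by (auto simp: interleaves_def)
qed

lemma interleaves_outward:
  assumes "interleaves j t" "i \<in> {1..k}" "1 \<le> t" "j + t \<le> m" "remaining s i j < t"
  shows "remaining s i (j + 1) < t"
proof -
  obtain q where q: "is_nth_last i j t q" using is_nth_last_exists[OF assms(2,3,4)] by blast
  have "remaining (Suc q) i (j + 1) = t - 1" using assms(1,2) q by (auto simp: interleaves_def)
  then show ?thesis
    using after_nth_last[OF q assms(5)] remaining_antimono[of "Suc q" s i "j + 1"] assms(3) by simp
qed

text \<open>
  By the two hypotheses, the \<open>t\<close>-th last fire at \<open>j\<close> precedes the \<open>t\<close>-th last fire at \<open>j - 1\<close> and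
  the \<open>(t - 1)\<close>-th last fire at \<open>j + 1\<close>. So at least \<open>t\<close> and \<open>t - 1\<close> fires of these neighbours
  remain after it. They cannot be more: \<open>t - 1\<close> fires of \<open>v\<^sub>i\<^sub>,\<^sub>j\<close> itself remain, and the number of
  chips left on it, \<open>1 + 2 (t - 1)\<close> minus the remaining fires of its neighbours, is nonnegative. At
  the centre the same comparison is made for the sum over all branches.
\<close>

lemma interleaves_step:
  assumes IH_in: "j \<ge> 1 \<Longrightarrow> interleaves (j - 1) t" and IH_out: "t \<ge> 2 \<Longrightarrow> interleaves (j + 1) (t - 1)"
    and t: "1 \<le> t" "j + t \<le> m"
  shows "interleaves j t"
  unfolding interleaves_def
proof (intro ballI allI impI)
  fix i s assume i: "i \<in> {1..k}" and s: "is_nth_last i j t s"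
  note s' = is_nth_lastD[OF s]
  have out: "t - 1 \<le> remaining (Suc s) i' (j + 1)" if i': "i' \<in> {1..k}" "j = 0 \<or> i' = i" for i'
  proof (rule ccontr)
    assume "\<not> ?thesis"
    then have less: "remaining s i' (j + 1) < t - 1" and "t \<ge> 2"
      using remaining_neighbor[OF s, of "j + 1" i'] by auto
    then have "remaining s i' j \<le> t - 1"
      using interleaves_inward[OF IH_out i'(1), of s] t by simp
    moreover have "remaining s i' j = remaining s i j"
      using i'(2) remaining_center by auto
    ultimately show False using s' by simp
  qed
  show "(j \<ge> 1 \<longrightarrow> remaining (Suc s) i (j - 1) = t) \<and>
     (\<forall>i'\<in>{1..k}. (j = 0 \<or> i' = i) \<longrightarrow> remaining (Suc s) i' (j + 1) = t - 1)"
  proof (cases "j = 0")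
    case True
    have "(\<Sum>i'\<in>{1..k}. int (remaining (Suc s) i' 1)) \<le> int k * int (t - 1)"
      using card_center_remaining[of "Suc s" i] s' i True by simp
    also have "\<dots> = (\<Sum>i'\<in>{1..k}. int (t - 1))" by simp
    finally have le: "(\<Sum>i'\<in>{1..k}. int (remaining (Suc s) i' 1)) \<le> (\<Sum>i'\<in>{1..k}. int (t - 1))" .
    have ge: "\<And>i'. i' \<in> {1..k} \<Longrightarrow> int (t - 1) \<le> int (remaining (Suc s) i' 1)"
      using out True by simp
    have "remaining (Suc s) i' 1 = t - 1" if "i' \<in> {1..k}" for i'
    proof (rule ccontr)
      assume "\<not> ?thesis"
      then have "int (t - 1) < int (remaining (Suc s) i' 1)" using ge[OF that] by linarith
      then have "(\<Sum>i'\<in>{1..k}. int (t - 1)) < (\<Sum>i'\<in>{1..k}. int (remaining (Suc s) i' 1))"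
        using ge that by (intro sum_strict_mono_ex1) auto
      then show False using le by linarith
    qed
    then show ?thesis using True by simp
  next
    case False
    then have j: "1 \<le> j" "j \<le> m" using t by auto
    have "t \<le> remaining s i (j - 1)"
    proof (rule ccontr)
      assume "\<not> ?thesis"
      then have "remaining s i j < t"
        using interleaves_outward[OF IH_in[OF j(1)] i t(1), of s] t j by simp
      then show False using s' by simp
    qed
    then have "t \<le> remaining (Suc s) i (j - 1)"
      using remaining_neighbor[OF s, of "j - 1" i] j by simp
    moreover have "int (remaining (Suc s) i (j - 1)) + int (remaining (Suc s) i (j + 1)) \<le> 1 + 2 * int (t - 1)"
      using card_branch_remaining[of "Suc s" i j] s' i j by simp
    ultimately show ?thesis using out[OF i] j s'(5) by auto
  qed
qed

text \<open>
  The recursion of \<open>interleaves_step\<close> goes from \<open>(j, t)\<close> to \<open>(j - 1, t)\<close> and \<open>(j + 1, t - 1)\<close>, so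
  it terminates lexicographically in \<open>t\<close> and \<open>j\<close>, and it does not leave the triangle.
\<close>

lemma last_fires_interleave: "1 \<le> t \<Longrightarrow> j + t \<le> m \<Longrightarrow> interleaves j t"
proof (induction t arbitrary: j)
  case 0
  then show ?case by simp
next
  case (Suc t)
  note IHt = Suc.IH
  from Suc.prems show ?case
  proof (induction j)
    case 0
    show ?case by (rule interleaves_step) (use IHt 0 in auto)
  next
    case (Suc j)
    show ?case by (rule interleaves_step) (use IHt Suc in auto)
  qed
qed

section \<open>Contents of the vertices\<close>

text \<open>
  In \<open>interleaves\<close> the bound given by the number of chips is attained, so no chip is left.
\<close>

lemma branch_emptied:
  assumes i: "i \<in> {1..k}" and "1 \<le> j" "j + t \<le> m" and s: "is_nth_last i j t s"
  shows "C (Suc s) (vtx i j) = {}"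
proof -
  note s' = is_nth_lastD[OF s]
  have "interleaves j t" using last_fires_interleave s'(5) assms by simp
  then have "remaining (Suc s) i (j - 1) = t" "remaining (Suc s) i (j + 1) = t - 1"
    using i s assms by (auto simp: interleaves_def)
  then have "int (card (C (Suc s) (vtx i j))) = 0"
    using card_branch_remaining[of "Suc s" i j] assms s' by simp
  then show ?thesis using finite_run[of "Suc s"] s'(1) by simp
qed

lemma center_emptied:
  assumes i: "i \<in> {1..k}" and "t \<le> m" and s: "is_nth_last i 0 t s"
  shows "C (Suc s) center = {}"
proof -
  note s' = is_nth_lastD[OF s]
  have "interleaves 0 t" using last_fires_interleave s'(5) assms by simp
  then have "remaining (Suc s) i' 1 = t - 1" if "i' \<in> {1..k}" for i'
    using i s that by (auto simp: interleaves_def)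
  then have "int (card (C (Suc s) center)) = 0"
    using card_center_remaining[of "Suc s" i] i s' by simp
  then show ?thesis using finite_run[of "Suc s"] s'(1) by simp
qed

lemma chip_stays:
  assumes "c \<in> C s (vtx i j)" "i \<in> {1..k}" "1 \<le> j" "s \<le> s'" "s' \<le> T"
    and "remaining s i j = remaining s' i j"
  shows "c \<in> C s' (vtx i j)"
  using assms(4-6)
proof (induction s' rule: dec_induct)
  case base
  show ?case by (rule assms(1))
next
  case (step q)
  have fire: "labeled_fire k (site q) (lo q) (hi q) (C q) (C (Suc q))"
    using stabilizing_run.step[OF stabilizing_run_axioms] step.prems(1) by simp
  have le: "remaining q i j \<le> remaining s i j" "remaining (Suc q) i j \<le> remaining q i j"
    using step.hyps by (simp_all add: remaining_antimono)
  then have eq: "remaining s i j = remaining q i j" using step.prems(2) by linarith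
  then have "c \<in> C q (vtx i j)" using step.IH step.prems(1) by linarith
  moreover have "site q \<noteq> vtx i j"
    using remaining_Suc[of q i j] eq step.prems by auto
  ultimately show ?case
    unfolding labeled_fire_branch_update[OF fire assms(2,3)] by simp
qed

lemma chip_arrived:
  assumes "s0 \<le> s" "C s0 v = {}" "c \<in> C s v"
  obtains q where "s0 \<le> q" "q < s" "c \<notin> C q v" "c \<in> C (Suc q) v"
proof -
  have "\<exists>q. s0 \<le> q \<and> q < s \<and> c \<notin> C q v \<and> c \<in> C (Suc q) v"
    using assms(1,3)
  proof (induction rule: dec_induct)
    case base
    then show ?case using assms(2) by simp
  next
    case (step q)
    show ?case
    proof (cases "c \<in> C q v")
      case True
      then show ?thesis using step.IH less_SucI by blast
    next
      case False
      then show ?thesis using step.hyps step.prems by blast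
    qed
  qed
  then show thesis using that by blast
qed

text \<open>
  The chip sent outwards by the \<open>(t + 1)\<close>-th last fire at \<open>j - 1\<close> arrives between the \<open>(t + 1)\<close>-th
  and the \<open>t\<close>-th last fire at \<open>j\<close>. It waits there, and since the latter fire empties the vertex,
  it takes part in it.
\<close>

lemma outward_chip_received:
  assumes i: "i \<in> {1..k}" and "1 \<le> j" "1 \<le> t" "j + t \<le> m"
    and p: "is_nth_last i (j - 1) (Suc t) p" and s: "is_nth_last i j t s"
  shows "hi p i \<in> {lo s, hi s i}"
proof -
  note p' = is_nth_lastD[OF p] and s' = is_nth_lastD[OF s]
  have "interleaves j t" "interleaves (j - 1) (Suc t)" using last_fires_interleave assms by auto
  have "t \<le> remaining p i j"
    using interleaves_inward[OF \<open>interleaves j t\<close> i, of p] p' assms by (cases "remaining p i j < t") auto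
  moreover have "remaining (Suc p) i j = remaining p i j"
    using remaining_neighbor[OF p, of j i] assms by simp
  moreover have "remaining (Suc p) i j < Suc t"
    using interleaves_outward[OF \<open>interleaves (j - 1) (Suc t)\<close> i, of "Suc p"] p' assms by simp
  ultimately have rem: "remaining (Suc p) i j = t" by simp
  have "Suc p \<le> s"
  proof (rule ccontr)
    assume "\<not> Suc p \<le> s"
    then have "remaining (Suc p) i j \<le> remaining (Suc s) i j" by (intro remaining_antimono) simp
    then show False using rem s' by simp
  qed
  have "hi p i \<in> C (Suc p) (vtx i j)"
    using labeled_fire_branch_update[OF step[OF p'(1)] i assms(2)] p' by simp
  then have "hi p i \<in> C s (vtx i j)"
    using chip_stays[of "hi p i" "Suc p" i j s] i assms(2) \<open>Suc p \<le> s\<close> rem s' by simp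
  moreover have "C (Suc s) (vtx i j) = {}" using branch_emptied[OF i assms(2,4) s] .
  ultimately show ?thesis
    using labeled_fire_branch_update[OF step[OF s'(1)] i assms(2)] s' by auto
qed

lemma remaining_at_nth_last:
  assumes "i \<in> {1..k}" "j + t \<le> m" "is_nth_last i j t s"
  shows "1 \<le> j \<Longrightarrow> remaining s i (j - 1) = t"
    and "i' \<in> {1..k} \<Longrightarrow> j = 0 \<or> i' = i \<Longrightarrow> remaining s i' (j + 1) = t - 1"
proof -
  have "interleaves j t" using last_fires_interleave is_nth_lastD(5)[OF assms(3)] assms(2) by simp
  then have after: "1 \<le> j \<Longrightarrow> remaining (Suc s) i (j - 1) = t"
    "i' \<in> {1..k} \<Longrightarrow> j = 0 \<or> i' = i \<Longrightarrow> remaining (Suc s) i' (j + 1) = t - 1"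
    using assms(1,3) unfolding interleaves_def by blast+
  show "remaining s i (j - 1) = t" if "1 \<le> j"
    using after(1) remaining_neighbor[OF assms(3), of "j - 1" i] that by simp
  show "remaining s i' (j + 1) = t - 1" if "i' \<in> {1..k}" "j = 0 \<or> i' = i"
    using after(2)[OF that] remaining_neighbor[OF assms(3), of "j + 1" i'] by simp
qed

text \<open>
  The vertex was emptied by its \<open>(t + 1)\<close>-th last fire, so every chip present at the \<open>t\<close>-th last fire
  arrived in between. By the interleaving, each neighbour fires exactly once in that interval.
\<close>

lemma branch_chip_origin:
  assumes i: "i \<in> {1..k}" and j: "1 \<le> j" "j + t < m"
    and p: "is_nth_last i (j - 1) (Suc t) p" and q: "is_nth_last i (j + 1) t q"
    and s: "is_nth_last i j t s" and c: "c \<in> C s (vtx i j)"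
  shows "c = hi p i \<or> c = lo q"
proof -
  note s' = is_nth_lastD[OF s]
  obtain r where r: "is_nth_last i j (Suc t) r" using is_nth_last_exists[of i "Suc t" j] i j by auto
  have "Suc r \<le> s" using after_nth_last[OF r, of s] s' by simp
  moreover have "C (Suc r) (vtx i j) = {}" using branch_emptied[OF i j(1) _ r] j by simp
  ultimately obtain e where e: "Suc r \<le> e" "e < s" "c \<notin> C e (vtx i j)" "c \<in> C (Suc e) (vtx i j)"
    using chip_arrived c by blast
  have "e < T" using e s' by simp
  then have "(site e = vtx i (j - 1) \<and> c = hi e i) \<or> (site e = vtx i (j + 1) \<and> c = lo e)"
    using labeled_fire_branch_update[OF step[OF \<open>e < T\<close>] i j(1)] e(3,4) by (auto split: if_splits)
  then show ?thesis
  proof (elim disjE conjE)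
    assume site: "site e = vtx i (j - 1)" and "c = hi e i"
    have "remaining e i (j - 1) \<le> remaining (Suc r) i (j - 1)"
      using e by (intro remaining_antimono)
    also have "\<dots> = Suc t"
      using remaining_at_nth_last(1)[OF i _ r] remaining_neighbor[OF r, of "j - 1" i] j by simp
    finally have "remaining e i (j - 1) \<le> Suc t" .
    moreover have "t \<le> remaining (Suc e) i (j - 1)"
      using remaining_at_nth_last(1)[OF i _ s] j remaining_antimono[of "Suc e" s i "j - 1"] e by simp
    ultimately have "is_nth_last i (j - 1) (Suc t) e"
      using remaining_Suc[OF \<open>e < T\<close>, of i "j - 1"] site \<open>e < T\<close> by (simp add: is_nth_last_def)
    then show ?thesis using is_nth_last_unique[OF p] \<open>c = hi e i\<close> by blast
  next
    assume site: "site e = vtx i (j + 1)" and "c = lo e"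
    have "remaining e i (j + 1) \<le> remaining (Suc r) i (j + 1)"
      using e by (intro remaining_antimono)
    also have "\<dots> = t"
      using remaining_at_nth_last(2)[OF i _ r, of i] remaining_neighbor[OF r, of "j + 1" i] j i by simp
    finally have "remaining e i (j + 1) \<le> t" .
    moreover have "t - 1 \<le> remaining (Suc e) i (j + 1)"
      using remaining_at_nth_last(2)[OF i _ s, of i] i j remaining_antimono[of "Suc e" s i "j + 1"] e by simp
    ultimately have "is_nth_last i (j + 1) t e"
      using remaining_Suc[OF \<open>e < T\<close>, of i "j + 1"] site \<open>e < T\<close> s'(5) by (simp add: is_nth_last_def)
    then show ?thesis using is_nth_last_unique[OF q] \<open>c = lo e\<close> by blast
  qed
qed

lemma center_chip_origin:
  assumes i: "i \<in> {1..k}" and t: "t < m"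
    and s: "is_nth_last i 0 t s" and c: "c \<in> C s center"
  shows "\<exists>i'\<in>{1..k}. \<exists>q. is_nth_last i' 1 t q \<and> c = lo q"
proof -
  note s' = is_nth_lastD[OF s]
  obtain r where r: "is_nth_last i 0 (Suc t) r" using is_nth_last_exists[of i "Suc t" 0] i t by auto
  have "Suc r \<le> s" using after_nth_last[OF r, of s] s' by simp
  moreover have "C (Suc r) center = {}" using center_emptied[OF i _ r] t by simp
  ultimately obtain e where e: "Suc r \<le> e" "e < s" "c \<notin> C e center" "c \<in> C (Suc e) center"
    using chip_arrived c by blast
  have "e < T" using e s' by simp
  then obtain i' where i': "i' \<in> {1..k}" and site: "site e = vtx i' 1" and "c = lo e"
    using labeled_fire_center_update[OF step[OF \<open>e < T\<close>]] e(3,4) by (auto split: if_splits)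
  have "remaining e i' 1 \<le> remaining (Suc r) i' 1"
    using e by (intro remaining_antimono)
  also have "\<dots> = t"
    using remaining_at_nth_last(2)[OF i _ r i'] remaining_neighbor[OF r, of 1 i'] t by simp
  finally have "remaining e i' 1 \<le> t" .
  moreover have "t - 1 \<le> remaining (Suc e) i' 1"
    using remaining_at_nth_last(2)[OF i _ s i'] t remaining_antimono[of "Suc e" s i' 1] e by simp
  ultimately have "is_nth_last i' 1 t e"
    using remaining_Suc[OF \<open>e < T\<close>, of i' 1] site \<open>e < T\<close> s'(5) by (simp add: is_nth_last_def)
  then show ?thesis using i' \<open>c = lo e\<close> by blast
qed

section \<open>Comparison of labels\<close>

text \<open>
  The fire \<open>p\<close> of the centre uses only chips \<open>a\<^sub>l\<close>, where \<open>a\<^sub>l\<close> is the smaller chip of the \<open>t\<close>-th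
  last fire of \<open>v\<^sub>l\<^sub>,\<^sub>1\<close>. Let \<open>h\<^sub>1 < \<dots> < h\<^sub>k\<close> be the chips of the previous fire \<open>r\<close> of the centre;
  \<open>h\<^sub>l\<close> takes part in the \<open>t\<close>-th last fire of \<open>v\<^sub>l\<^sub>,\<^sub>1\<close>. For \<open>l < i\<close> this gives
  \<open>a\<^sub>l \<le> h\<^sub>l < h\<^sub>i \<le> hi s i\<close>, and \<open>a\<^sub>i < hi s i\<close> is clear. So at most \<open>k - i\<close> of the chips \<open>a\<^sub>l\<close> are
  at least \<open>hi s i\<close>. If the \<open>i\<close>-th smallest chip of \<open>p\<close> were at least \<open>hi s i\<close>, there would be
  \<open>k - i + 1\<close> such chips.
\<close>

lemma center_outward_chip_less:
  assumes i: "i \<in> {1..k}" and "1 \<le> t" "Suc t \<le> m"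
    and p: "is_nth_last i 0 t p" and s: "is_nth_last i 1 t s"
  shows "hi p i < hi s i"
proof -
  have ex: "\<exists>q. is_nth_last i' 1 t q" if "i' \<in> {1..k}" for i'
    using is_nth_last_exists[of i' t 1] that assms by auto
  define q where "q i' = (SOME q. is_nth_last i' 1 t q)" for i'
  have q: "is_nth_last i' 1 t (q i')" if "i' \<in> {1..k}" for i'
    unfolding q_def using ex[OF that] by (rule someI_ex)
  have qi: "q i = s" using is_nth_last_unique q[OF i] s by simp
  obtain r where r: "is_nth_last i 0 (Suc t) r" using is_nth_last_exists[of i "Suc t" 0] assms by auto
  have r_all: "is_nth_last i' 0 (Suc t) r" for i'
    using r by (simp add: is_nth_last_def remaining_center[of _ i' i])
  have mono_r: "strict_mono_on {1..k} (hi r)"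
    using labeled_fire_at_center(1) step is_nth_lastD[OF r] by (metis vtx_0)
  have p': "strict_mono_on {1..k} (hi p)" "hi p ` {1..k} \<subseteq> C p center"
    using labeled_fire_at_center step is_nth_lastD[OF p] by (metis vtx_0)+
  have recv: "hi r i' \<in> {lo (q i'), hi (q i') i'}" and lt: "lo (q i') < hi (q i') i'"
    if "i' \<in> {1..k}" for i'
  proof -
    show "hi r i' \<in> {lo (q i'), hi (q i') i'}"
      by (rule outward_chip_received[OF that, of 1 t]) (use assms q[OF that] r_all in auto)
    show "lo (q i') < hi (q i') i'"
      using labeled_fire_at_branch(1)[of k i' 1] step is_nth_lastD[OF q[OF that]] by (metis order_refl)
  qed
  have small: "lo (q i') < hi s i" if "i' \<in> {1..i}" for i'
  proof (cases "i' = i")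
    case True
    then show ?thesis using lt[OF i] qi by simp
  next
    case False
    have i'': "i' \<in> {1..k}" "i' < i" using that i False by auto
    have "lo (q i') \<le> hi r i'" using recv[OF i''(1)] lt[OF i''(1)] by auto
    also have "hi r i' < hi r i" using mono_r i'' i by (auto simp: strict_mono_on_def)
    also have "hi r i \<le> hi s i" using recv[OF i] lt[OF i] qi by auto
    finally show ?thesis .
  qed
  show ?thesis
  proof (rule ccontr)
    assume contr: "\<not> ?thesis"
    have "hi p ` {i..k} \<subseteq> (\<lambda>i'. lo (q i')) ` {Suc i..k}"
    proof
      fix c assume "c \<in> hi p ` {i..k}"
      then obtain l where l: "c = hi p l" "l \<in> {i..k}" by blast
      have "hi p i \<le> hi p l"
        using strict_mono_on_leD[OF p'(1)] l i by simp
      then have "hi s i \<le> c" using contr l by simp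
      have "c \<in> C p center" using p'(2) l i by auto
      then obtain i' q' where i': "i' \<in> {1..k}" "is_nth_last i' 1 t q'" "c = lo q'"
        using center_chip_origin[OF i _ p \<open>c \<in> C p center\<close>] assms by auto
      then have "c = lo (q i')" using is_nth_last_unique[OF q[OF i'(1)]] by blast
      moreover have "i' \<notin> {1..i}" using small[of i'] calculation \<open>hi s i \<le> c\<close> by auto
      ultimately show "c \<in> (\<lambda>i'. lo (q i')) ` {Suc i..k}" using i'(1) by auto
    qed
    then have "card (hi p ` {i..k}) \<le> card ((\<lambda>i'. lo (q i')) ` {Suc i..k})"
      by (intro card_mono) auto
    also have "\<dots> \<le> card {Suc i..k}" by (rule card_image_le) simp
    also have "\<dots> = k - i" by simp
    also have "card (hi p ` {i..k}) = card {i..k}"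
      using strict_mono_on_imp_inj_on[OF p'(1)] i by (intro card_image) (auto elim: inj_on_subset)
    finally show False using i by auto
  qed
qed

text \<open>
  The chip \<open>hi p i\<close> came to its vertex either from outside, and then it is the smaller chip of the
  fire \<open>s\<close>, or from inside, and then the induction hypothesis for \<open>t + 1\<close> places it below the chip
  \<open>hi q i\<close>, which takes part in the fire \<open>s\<close>.
\<close>

lemma outward_chips_increase:
  assumes "i \<in> {1..k}" "1 \<le> t" "Suc j + t \<le> m"
    and "is_nth_last i j t p" "is_nth_last i (Suc j) t s"
  shows "hi p i < hi s i"
  using assms
proof (induction j arbitrary: t p s)
  case 0
  then show ?case using center_outward_chip_less by simp
next
  case (Suc j)
  note i = Suc.prems(1)
  obtain r where r: "is_nth_last i j (Suc t) r" using is_nth_last_exists[of i "Suc t" j] Suc.prems by auto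
  obtain q where q: "is_nth_last i (Suc j) (Suc t) q"
    using is_nth_last_exists[of i "Suc t" "Suc j"] Suc.prems by auto
  have p_in: "hi p i \<in> C p (vtx i (Suc j))"
    using labeled_fire_at_branch(3)[of k i "Suc j"] step is_nth_lastD[OF Suc.prems(4)] by (metis Suc_le_mono le0 One_nat_def)
  have s_lt: "lo s < hi s i"
    using labeled_fire_at_branch(1)[of k i "Suc (Suc j)"] step is_nth_lastD[OF Suc.prems(5)] by (metis Suc_le_mono le0 One_nat_def)
  have "hi p i = hi r i \<or> hi p i = lo s"
    by (rule branch_chip_origin[OF i, of "Suc j" t]) (use Suc.prems r p_in in auto)
  then show ?case
  proof
    assume "hi p i = hi r i"
    also have "hi r i < hi q i" by (rule Suc.IH[OF i _ _ r q]) (use Suc.prems in auto)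
    also have "hi q i \<in> {lo s, hi s i}"
      by (rule outward_chip_received[OF i, of "Suc (Suc j)" t]) (use Suc.prems q in auto)
    then have "hi q i \<le> hi s i" using s_lt by auto
    finally show ?thesis .
  qed (use s_lt in simp)
qed

text \<open>
  After the last fire at \<open>j\<close> there is no further fire at \<open>j + 1\<close>, so the chip sent there stays.
\<close>

lemma final_chip:
  assumes i: "i \<in> {1..k}" and j: "Suc j \<le> m" and p: "is_nth_last i j 1 p"
  shows "C T (vtx i (Suc j)) = {hi p i}"
proof -
  note p' = is_nth_lastD[OF p]
  have "interleaves j 1" using last_fires_interleave j by simp
  then have "remaining (Suc p) i (Suc j) = 0"
    using interleaves_outward[of j 1 i "Suc p"] i j p' by simp
  moreover have "hi p i \<in> C (Suc p) (vtx i (Suc j))"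
    using labeled_fire_branch_update[OF step[OF p'(1)] i, of "Suc j"] p' by simp
  ultimately have "hi p i \<in> C T (vtx i (Suc j))"
    using chip_stays[of "hi p i" "Suc p" i "Suc j" T] i p' by simp
  moreover have "card (C T (vtx i (Suc j))) = 1" using card_final[OF i] j by simp
  ultimately show ?thesis by (auto simp: card_1_singleton_iff)
qed

lemma branches_sorted:
  assumes "i \<in> {1..k}" "1 \<le> j" "Suc j \<le> m"
  shows "\<exists>a b. C T (vtx i j) = {a} \<and> C T (vtx i (j + 1)) = {b} \<and> a < b"
proof -
  obtain p where p: "is_nth_last i (j - 1) 1 p" using is_nth_last_exists[of i 1 "j - 1"] assms by auto
  obtain s where s: "is_nth_last i j 1 s" using is_nth_last_exists[of i 1 j] assms by auto
  have "C T (vtx i j) = {hi p i}" using final_chip[OF assms(1) _ p] assms by simp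
  moreover have "C T (vtx i (j + 1)) = {hi s i}" using final_chip[OF assms(1) _ s] assms by simp
  moreover have "hi p i < hi s i"
    using outward_chips_increase[OF assms(1), of 1 "j - 1" p s] p s assms by simp
  ultimately show ?thesis by blast
qed

end

theorem theorem4p1:
  fixes k m :: nat and C :: config
  assumes "k \<ge> 1" and "m \<ge> 1"
    and "reachable k (initial_config k m) C" and "stable k C"
  shows "\<forall>i \<in> {1..k}. \<forall>j \<in> {1..m - 1}.
           \<exists>a b. C (vtx i j) = {a} \<and> C (vtx i (j + 1)) = {b} \<and> a < b"
proof (intro ballI)
  fix i j assume ij: "i \<in> {1..k}" "j \<in> {1..m - 1}"
  obtain T Cs site lo hi where run: "Cs 0 = initial_config k m" "Cs T = C"
    "\<forall>s<T. labeled_fire k (site s) (lo s) (hi s) (Cs s) (Cs (Suc s))"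
    using reachable_imp_run[OF assms(3)] by blast
  interpret stabilizing_run k m T Cs site lo hi
    by unfold_locales (use run assms in auto)
  show "\<exists>a b. C (vtx i j) = {a} \<and> C (vtx i (j + 1)) = {b} \<and> a < b"
    using branches_sorted[of i j] ij run(2) by auto
qed

end
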